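(* Let $(\Omega,\Sigma,\mu)$ be a $\sigma$-finite complete measure space, let $\Phi_1,\Phi_2$ be Young functions, and let $u:\Omega\to\mathbb{C}$ be a measurable function. Then: (a) If there are $M>0$, $g\in L^1_+(\Omega)$ and $A\in\Sigma$ with $\mu(A)=0$ such that $\Phi_2(|u(x)|v)\le\Phi_1(Mv)+g(x)$ for all $v>0$ and all $x\in\Omega\setminus A$, then $M_u:L^{\Phi_1}(\Omega)\to L^{\Phi_2}(\Omega)$, $M_uf=u\cdot f$, is a bounded operator. (b) If $(\Omega,\Sigma,\mu)$ is a non-atomic measure space and the operator $M_u:L^{\Phi_1}(\Omega)\to L^{\Phi_2}(\Omega)$ is bounded, then there exist $M>0$, $g\in L^1_+(\Omega)$ and $A\in\Sigma$ with $\mu(A)=0$ such that $\Phi_2(|u(x)|v)\le\Phi_1(Mv)+g(x)$ for all $v>0$ and all $x\in\Omega\setminus A$.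
   Context: A Young function is a continuous convex function $\Phi:\mathbb{R}\to\mathbb{R}^+=[0,\infty)$ such that $\Phi(x)=0$ iff $x=0$, $\lim_{x\to\infty}\Phi(x)=\infty$ and $\lim_{x\to\infty}\Phi(x)/x=\infty$. For a Young function $\Phi$, the Orlicz space $L^\Phi(\Omega)=L^\Phi(\Omega,\Sigma,\mu)$ is the set of ($\mu$-a.e. classes of) $\Sigma$-measurable $f:\Omega\to\mathbb{C}$ such that $\int_\Omega\Phi(k|f|)\,d\mu<\infty$ for some $k>0$. It is a Banach space with norm $N_\Phi(f)=\inf\{k>0:\int_\Omega\Phi(|f|/k)\,d\mu\le 1\}$. $L^1_+(\Omega)$ is the set of nonnegative $\mu$-integrable functions on $\Omega$. $M_u:L^{\Phi_1}(\Omega)\to L^{\Phi_2}(\Omega)$ is bounded means that $uf\in L^{\Phi_2}(\Omega)$ for all $f\in L^{\Phi_1}(\Omega)$ and there is $C>0$ with $N_{\Phi_2}(uf)\le C\,N_{\Phi_1}(f)$ for all such $f$. *)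

theory Defs
  imports "HOL-Analysis.Analysis"
begin

definition young_function :: "(real \<Rightarrow> real) \<Rightarrow> bool" where
  "young_function \<Phi> \<longleftrightarrow>
     continuous_on UNIV \<Phi> \<and> convex_on UNIV \<Phi> \<and>
     (\<forall>x. 0 \<le> \<Phi> x) \<and> (\<forall>x. \<Phi> x = 0 \<longleftrightarrow> x = 0) \<and>
     filterlim \<Phi> at_top at_top \<and> filterlim (\<lambda>x. \<Phi> x / x) at_top at_top"

(* Orlicz spaces are represented by their measurable functions, not by classes modulo
   a.e. equality; membership and the norm depend only on the class. *)
definition orlicz_space :: "(real \<Rightarrow> real) \<Rightarrow> 'a measure \<Rightarrow> ('a \<Rightarrow> complex) set" where
  "orlicz_space \<Phi> \<mu> =
     {f \<in> borel_measurable \<mu>. \<exists>k>0. (\<integral>\<^sup>+x. ennreal (\<Phi> (k * cmod (f x))) \<partial>\<mu>) < \<infinity>}"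

(* Only meaningful for f in orlicz_space: the infimum is real-valued, so it is
   unspecified when the set is empty. *)
definition orlicz_norm :: "(real \<Rightarrow> real) \<Rightarrow> 'a measure \<Rightarrow> ('a \<Rightarrow> complex) \<Rightarrow> real" where
  "orlicz_norm \<Phi> \<mu> f =
     Inf {k. 0 < k \<and> (\<integral>\<^sup>+x. ennreal (\<Phi> (cmod (f x) / k)) \<partial>\<mu>) \<le> 1}"

definition mult_op :: "('a \<Rightarrow> complex) \<Rightarrow> ('a \<Rightarrow> complex) \<Rightarrow> 'a \<Rightarrow> complex" where
  "mult_op u f = (\<lambda>x. u x * f x)"

definition bounded_orlicz_operator ::
  "(real \<Rightarrow> real) \<Rightarrow> (real \<Rightarrow> real) \<Rightarrow> 'a measure \<Rightarrow>
   (('a \<Rightarrow> complex) \<Rightarrow> 'a \<Rightarrow> complex) \<Rightarrow> bool" where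
  "bounded_orlicz_operator \<Phi>\<^sub>1 \<Phi>\<^sub>2 \<mu> T \<longleftrightarrow>
     (\<forall>f \<in> orlicz_space \<Phi>\<^sub>1 \<mu>. T f \<in> orlicz_space \<Phi>\<^sub>2 \<mu>) \<and>
     (\<exists>C>0. \<forall>f \<in> orlicz_space \<Phi>\<^sub>1 \<mu>.
        orlicz_norm \<Phi>\<^sub>2 \<mu> (T f) \<le> C * orlicz_norm \<Phi>\<^sub>1 \<mu> f)"

definition L1_nonneg :: "'a measure \<Rightarrow> ('a \<Rightarrow> real) set" where
  "L1_nonneg \<mu> = {g. integrable \<mu> g \<and> (\<forall>x \<in> space \<mu>. 0 \<le> g x)}"

definition measure_atom :: "'a measure \<Rightarrow> 'a set \<Rightarrow> bool" where
  "measure_atom \<mu> A \<longleftrightarrow> A \<in> sets \<mu> \<and> 0 < emeasure \<mu> A \<and>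
     (\<forall>B \<in> sets \<mu>. B \<subseteq> A \<longrightarrow> emeasure \<mu> B = 0 \<or> emeasure \<mu> B = emeasure \<mu> A)"

definition nonatomic :: "'a measure \<Rightarrow> bool" where
  "nonatomic \<mu> \<longleftrightarrow> (\<nexists>A. measure_atom \<mu> A)"

end

theory Submission
  imports Defs
begin

text \<open>
  Sufficiency is convexity. If \<open>\<Phi>\<^sub>2 (\<bar>u\<bar> v) \<le> \<Phi>\<^sub>1 (M v) + g\<close> and \<open>k\<close> exceeds the norm of \<open>f\<close>, then putting
  \<open>v = \<bar>f\<bar> / (M k)\<close> and integrating gives \<open>\<integral>\<Phi>\<^sub>2 (\<bar>u f\<bar> / (M k)) \<le> 1 + \<integral>g\<close>. A further division of the
  argument by \<open>1 + \<integral>g\<close> brings this down to \<open>1\<close>, so \<open>M (1 + \<integral>g)\<close> bounds the operator norm.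

  For necessity, boundedness gives a constant \<open>K\<close> such that \<open>\<integral>\<Phi>\<^sub>1 (\<bar>f\<bar>) \<le> 1\<close> implies
  \<open>\<integral>\<Phi>\<^sub>2 (\<bar>u f\<bar> / K) \<le> 1\<close>. Take for \<open>g\<close> the supremum over \<open>w \<ge> 0\<close> of the excess
  \<open>G x w = \<Phi>\<^sub>2 (\<bar>u x\<bar> w / K) - 2 \<Phi>\<^sub>1 w\<close>; the factor \<open>2\<close> costs nothing, as \<open>2 \<Phi>\<^sub>1 w \<le> \<Phi>\<^sub>1 (2 w)\<close>. Let \<open>s\<close> be
  a measurable choice of a maximiser of \<open>G x\<close> among \<open>0\<close> and finitely many rationals. Then
  \<open>\<Phi>\<^sub>2 (\<bar>u\<bar> s / K) \<ge> 2 \<Phi>\<^sub>1 s\<close> everywhere. If \<open>\<integral>\<Phi>\<^sub>1 s\<close> exceeded \<open>1\<close>, nonatomicity would give a set \<open>E\<close> with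
  \<open>1/2 < \<integral>\<^sub>E \<Phi>\<^sub>1 s \<le> 1\<close>, and then \<open>\<integral>\<^sub>E \<Phi>\<^sub>2 (\<bar>u\<bar> s / K) > 1\<close>, which contradicts the choice of \<open>K\<close> for
  the function \<open>s\<close> cut off to \<open>E\<close>. Hence \<open>\<integral>\<Phi>\<^sub>1 s \<le> 1\<close>, so the excess at \<open>s\<close> has integral at most \<open>1\<close>
  (\<open>excess_integral_le_1\<close>). Exhausting the rationals, monotone convergence makes the supremum
  integrable, and continuity of the Young functions extends the bound from rationals to all \<open>v\<close>.

  The set \<open>E\<close> comes from \<open>nonatomic_subset_of_comparable_measure\<close>, applied to the measure with
  density \<open>\<Phi>\<^sub>1 s\<close>, which inherits nonatomicity (\<open>nonatomic_density\<close>).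
\<close>

section \<open>Sets of prescribed size in nonatomic measure spaces\<close>

lemma (in sigma_finite_measure) exists_finite_positive_subset:
  assumes A: "A \<in> sets M" "0 < emeasure M A"
  shows "\<exists>B\<in>sets M. B \<subseteq> A \<and> 0 < emeasure M B \<and> emeasure M B < \<infinity>"
proof -
  obtain F :: "nat \<Rightarrow> 'a set" where F: "range F \<subseteq> sets M" "(\<Union>i. F i) = space M"
      "\<And>i. emeasure M (F i) \<noteq> \<infinity>"
    using sigma_finite by metis
  have *: "A = (\<Union>i. A \<inter> F i)"
    using F(2) sets.sets_into_space[OF A(1)] by auto
  have "\<exists>i. emeasure M (A \<inter> F i) \<noteq> 0"
  proof (rule ccontr)
    assume "\<not> ?thesis"
    then have "(\<Union>i. A \<inter> F i) \<in> null_sets M"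
      using A F(1) by (intro null_sets_UN) (auto simp: null_sets_def)
    then show False using A(2) * by (auto simp: null_sets_def)
  qed
  then obtain i where i: "emeasure M (A \<inter> F i) \<noteq> 0" by blast
  have "emeasure M (A \<inter> F i) \<le> emeasure M (F i)"
    using F(1) by (intro emeasure_mono) auto
  then have "emeasure M (A \<inter> F i) < \<infinity>"
    using F(3)[of i] by (simp add: order_le_less_trans less_top)
  then show ?thesis
    using i A F(1) by (intro bexI[of _ "A \<inter> F i"]) (auto simp: zero_less_iff_neq_zero)
qed

lemma nonatomic_splits:
  assumes "nonatomic M" and A: "A \<in> sets M" "0 < emeasure M A"
  shows "\<exists>B\<in>sets M. B \<subseteq> A \<and> 0 < emeasure M B \<and> 0 < emeasure M (A - B)"
proof -
  obtain B where B: "B \<in> sets M" "B \<subseteq> A" "emeasure M B \<noteq> 0" "emeasure M B \<noteq> emeasure M A"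
    using assms unfolding nonatomic_def measure_atom_def by blast
  have "emeasure M A = emeasure M B + emeasure M (A - B)"
    using B A by (subst plus_emeasure) (auto simp: Un_absorb1)
  then have "emeasure M (A - B) \<noteq> 0" using B(4) by auto
  then show ?thesis using B by (auto simp: zero_less_iff_neq_zero)
qed

text \<open>An atom of a \<open>\<sigma>\<close>-finite measure has finite measure, so it cannot contain two disjoint sets of
  positive measure. But on the part where \<open>f\<close> does not vanish, the sets that are null for the density
  are null for \<open>M\<close>, so a splitting for \<open>M\<close> is a splitting for the density. Finiteness is essential
  here: the constant density \<open>\<infinity>\<close> turns every set of positive measure into an atom.\<close>

lemma nonatomic_density:
  fixes f :: "'a \<Rightarrow> ennreal"
  assumes "nonatomic M" and f[measurable]: "f \<in> borel_measurable M"
    and sf: "sigma_finite_measure (density M f)"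
  shows "nonatomic (density M f)"
  unfolding nonatomic_def
proof
  let ?N = "density M f"
  assume "\<exists>A. measure_atom ?N A"
  then obtain A where A[measurable]: "A \<in> sets M" and pos: "0 < emeasure ?N A"
    and atom: "\<And>B. B \<in> sets M \<Longrightarrow> B \<subseteq> A \<Longrightarrow> emeasure ?N B = 0 \<or> emeasure ?N B = emeasure ?N A"
    unfolding measure_atom_def by auto
  interpret N: sigma_finite_measure ?N by (rule sf)
  have fin: "emeasure ?N A < \<infinity>"
    using N.exists_finite_positive_subset[of A] atom pos by (auto; metis less_irrefl)
  define A' where "A' = {x \<in> A \<inter> space M. f x \<noteq> 0}"
  have A'[measurable]: "A' \<in> sets M" unfolding A'_def by simp
  have null: "emeasure ?N S = 0 \<longleftrightarrow> (AE x in M. x \<in> S \<longrightarrow> f x = 0)" if "S \<in> sets M" for S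
    using null_sets_density_iff[OF f, of S] that by (auto simp: null_sets_def)
  have A'pos: "emeasure ?N S \<noteq> 0" if S: "S \<in> sets M" "S \<subseteq> A'" "0 < emeasure M S" for S
  proof
    assume "emeasure ?N S = 0"
    then have "AE x in M. x \<in> S \<longrightarrow> f x = 0" using null S(1) by blast
    then have "AE x in M. x \<notin> S"
      by (rule AE_mp) (use S(2) in \<open>auto simp: A'_def\<close>)
    then have "S \<in> null_sets M" using AE_iff_null_sets[OF S(1)] by blast
    then show False using S(3) by (auto simp: null_sets_def)
  qed
  have "0 < emeasure M A'"
  proof (rule ccontr)
    assume "\<not> ?thesis"
    then have "A' \<in> null_sets M" using A' by (auto simp: null_sets_def)
    then have "AE x in M. x \<notin> A'" using AE_iff_null_sets[OF A'] by blast
    then have "AE x in M. x \<in> A \<longrightarrow> f x = 0"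
      by (rule AE_mp) (auto simp: A'_def)
    then show False using null[OF A] pos by simp
  qed
  from nonatomic_splits[OF \<open>nonatomic M\<close> A' this] obtain B
    where B: "B \<in> sets M" "B \<subseteq> A'" "0 < emeasure M B" "0 < emeasure M (A' - B)" by blast
  have BA: "B \<subseteq> A" using B(2) by (auto simp: A'_def)
  have nB: "emeasure ?N B \<noteq> 0" using A'pos[of B] B by auto
  have finB: "emeasure ?N B \<noteq> \<infinity>"
    using emeasure_mono[OF BA, of ?N] fin by (auto simp: top_unique)
  have "emeasure ?N (A' - B) \<noteq> 0" using A'pos[of "A' - B"] B by auto
  moreover have "emeasure ?N (A' - B) \<le> emeasure ?N (A - B)"
    using B A by (intro emeasure_mono) (auto simp: A'_def)
  moreover have "emeasure ?N (A - B) = emeasure ?N A - emeasure ?N B"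
    using B(1) A BA finB by (intro emeasure_Diff) auto
  ultimately show False
    using atom[OF B(1) BA] nB fin by (auto simp: ennreal_minus_eq_0 diff_eq_0_iff_ennreal)
qed

text \<open>Split a set of finite positive measure in two repeatedly, keeping the smaller part.\<close>

lemma (in sigma_finite_measure) nonatomic_small_subset:
  assumes "nonatomic M" and A: "A \<in> sets M" "0 < emeasure M A" and \<epsilon>: "0 < (\<epsilon>::real)"
  shows "\<exists>B\<in>sets M. B \<subseteq> A \<and> 0 < emeasure M B \<and> emeasure M B \<le> ennreal \<epsilon>"
proof -
  obtain A0 where A0: "A0 \<in> sets M" "A0 \<subseteq> A" "0 < emeasure M A0" "emeasure M A0 < \<infinity>"
    using exists_finite_positive_subset[OF A] by blast
  have halving: "\<exists>B\<in>sets M. B \<subseteq> A0 \<and> 0 < measure M B \<and> 2 ^ n * measure M B \<le> measure M A0" for n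
  proof (induction n)
    case 0
    have "0 < measure M A0" using A0 by (simp add: measure_def enn2real_positive_iff)
    then show ?case using A0 by auto
  next
    case (Suc n)
    then obtain B where B: "B \<in> sets M" "B \<subseteq> A0" "0 < measure M B"
        "2 ^ n * measure M B \<le> measure M A0" by blast
    have fin: "emeasure M S < \<infinity>" if "S \<subseteq> A0" for S
      using emeasure_mono[OF that A0(1)] A0(4) by (rule le_less_trans)
    have "0 < emeasure M B" using B(3) by (metis measure_def enn2real_0 less_irrefl zero_less_iff_neq_zero)
    from nonatomic_splits[OF assms(1) B(1) this] obtain D
      where D: "D \<in> sets M" "D \<subseteq> B" "0 < emeasure M D" "0 < emeasure M (B - D)" by blast
    have sum: "measure M B = measure M D + measure M (B - D)"
      using B D fin[of B] by (subst measure_Diff) (auto simp: less_top)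
    have pos: "0 < measure M D" "0 < measure M (B - D)"
      using D B(2) fin[of D] fin[of "B - D"] by (auto simp: measure_def enn2real_positive_iff)
    obtain E where E: "E \<in> sets M" "E \<subseteq> B" "0 < measure M E" "2 * measure M E \<le> measure M B"
    proof (cases "measure M D \<le> measure M (B - D)")
      case True
      then show ?thesis using that[of D] D sum pos by auto
    next
      case False
      then show ?thesis using that[of "B - D"] B(1) D sum pos by auto
    qed
    have "2 ^ Suc n * measure M E = 2 ^ n * (2 * measure M E)" by simp
    also have "\<dots> \<le> 2 ^ n * measure M B" using E(4) by (intro mult_left_mono) auto
    also have "\<dots> \<le> measure M A0" by (rule B(4))
    finally show ?case using E B(2) by blast
  qed
  obtain n where n: "measure M A0 / \<epsilon> < 2 ^ n"
    using real_arch_pow[of 2 "measure M A0 / \<epsilon>"] by auto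
  obtain B where B: "B \<in> sets M" "B \<subseteq> A0" "0 < measure M B"
      "2 ^ n * measure M B \<le> measure M A0" using halving by blast
  have "measure M A0 < 2 ^ n * \<epsilon>" using n \<epsilon> by (simp add: field_simps)
  then have "2 ^ n * measure M B \<le> 2 ^ n * \<epsilon>" using B(4) by linarith
  then have "measure M B \<le> \<epsilon>" by simp
  moreover have "emeasure M B = ennreal (measure M B)"
    using emeasure_mono[OF B(2) A0(1)] A0(4) by (intro emeasure_eq_ennreal_measure) (auto simp: top_unique)
  ultimately show ?thesis
    using B A0(2) by (intro bexI[of _ B]) (auto simp: ennreal_leI)
qed

text \<open>This is a weak form of Sierpinski's theorem on intermediate values of nonatomic measures.
  If no subset has measure in \<open>(c/2, c]\<close>, then the subsets of measure at most \<open>c/2\<close> are closed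
  under unions of two sets, since such a union has measure at most \<open>c\<close>. Hence an increasing union of
  them attains the largest measure in this family. But its complement in \<open>A\<close> still contains a
  small set of positive measure, which can be added to it.\<close>

lemma (in sigma_finite_measure) nonatomic_subset_of_comparable_measure:
  assumes na: "nonatomic M" and A: "A \<in> sets M" "ennreal c < emeasure M A" and c: "0 < (c::real)"
  shows "\<exists>E\<in>sets M. E \<subseteq> A \<and> ennreal (c/2) < emeasure M E \<and> emeasure M E \<le> ennreal c"
proof (rule ccontr)
  assume neg: "\<not> ?thesis"
  define \<S> where "\<S> = {E \<in> sets M. E \<subseteq> A \<and> emeasure M E \<le> ennreal (c/2)}"
  have small: "E \<in> \<S>" if "E \<in> sets M" "E \<subseteq> A" "emeasure M E \<le> ennreal c" for E
    using neg that by (auto simp: \<S>_def not_less)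
  have half: "ennreal (c/2) + ennreal (c/2) = ennreal c"
    using c by (simp flip: ennreal_plus)
  have Un: "E \<union> F \<in> \<S>" if "E \<in> \<S>" "F \<in> \<S>" for E F
  proof (rule small)
    have "emeasure M (E \<union> F) \<le> emeasure M E + emeasure M F"
      using that by (intro emeasure_subadditive) (auto simp: \<S>_def)
    also have "\<dots> \<le> ennreal (c/2) + ennreal (c/2)"
      using that by (intro add_mono) (auto simp: \<S>_def)
    finally show "emeasure M (E \<union> F) \<le> ennreal c" using half by simp
  qed (use that in \<open>auto simp: \<S>_def\<close>)
  have ne: "{} \<in> \<S>" by (auto simp: \<S>_def)
  then have "emeasure M ` \<S> \<noteq> {}" by blast
  from ennreal_Sup_countable_SUP[OF this] obtain m :: "nat \<Rightarrow> ennreal"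
    where m: "range m \<subseteq> emeasure M ` \<S>" "Sup (emeasure M ` \<S>) = (SUP i. m i)" by blast
  then have "\<forall>i. \<exists>F\<in>\<S>. m i = emeasure M F" by blast
  then obtain F where F: "\<And>i. F i \<in> \<S>" "\<And>i. m i = emeasure M (F i)" by metis
  define U where "U n = (\<Union>i\<le>n. F i)" for n
  have U: "U n \<in> \<S>" for n
    by (induction n) (auto simp: U_def atMost_Suc F Un)
  define E where "E = (\<Union>n. U n)"
  have Us: "range U \<subseteq> sets M" using U by (auto simp: \<S>_def)
  have "incseq U" by (intro incseq_SucI) (auto simp: U_def atMost_Suc)
  then have "emeasure M E = (SUP n. emeasure M (U n))"
    unfolding E_def using Us by (intro SUP_emeasure_incseq[symmetric]) auto
  also have "\<dots> \<le> ennreal (c/2)" using U by (intro SUP_least) (auto simp: \<S>_def)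
  finally have E_le: "emeasure M E \<le> ennreal (c/2)" .
  have E: "E \<in> \<S>" using E_le U Us by (auto simp: E_def \<S>_def)
  have "Sup (emeasure M ` \<S>) \<le> emeasure M E"
    unfolding m(2)
  proof (rule SUP_least)
    fix i
    have "F i \<subseteq> E" by (auto simp: E_def U_def)
    then show "m i \<le> emeasure M E" using E by (auto simp: F(2) \<S>_def intro: emeasure_mono)
  qed
  then have max: "emeasure M S \<le> emeasure M E" if "S \<in> \<S>" for S
    using that by (meson Sup_upper image_eqI order_trans)
  have "emeasure M A \<noteq> emeasure M E"
    using A(2) E_le c by (metis ennreal_leI field_sum_of_halves le_less_trans less_add_same_cancel2 
        less_eq_real_def not_less half_gt_zero)
  moreover have "emeasure M A = emeasure M E + emeasure M (A - E)"
    using E A by (subst plus_emeasure) (auto simp: Un_absorb1 \<S>_def)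
  ultimately have "emeasure M (A - E) \<noteq> 0" by auto
  then have "0 < emeasure M (A - E)" by (simp add: zero_less_iff_neq_zero)
  with nonatomic_small_subset[OF na, of "A - E" "c/2"] c E A obtain B
    where B: "B \<in> sets M" "B \<subseteq> A - E" "0 < emeasure M B" "emeasure M B \<le> ennreal (c/2)"
    by (auto simp: \<S>_def)
  have "emeasure M E + emeasure M B = emeasure M (E \<union> B)"
    using B E by (intro plus_emeasure) (auto simp: \<S>_def)
  also have "\<dots> \<le> emeasure M E"
    using B E by (intro max Un) (auto simp: \<S>_def)
  finally have "emeasure M E + emeasure M B \<le> emeasure M E + 0" by simp
  moreover have "emeasure M E \<noteq> top" using E_le by (auto simp: top_unique)
  ultimately show False using B(3) by (simp only: ennreal_add_left_cancel_le) auto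
qed

section \<open>Young functions, the modular and the norm\<close>

lemma young_function_scale:
  assumes "young_function \<Phi>" "0 \<le> t" "t \<le> 1"
  shows "\<Phi> (t * x) \<le> t * \<Phi> x"
proof -
  have "convex_on UNIV \<Phi>" "\<Phi> 0 = 0" using assms by (auto simp: young_function_def)
  then show ?thesis using convex_onD[of UNIV \<Phi> t 0 x] assms by simp
qed

lemma young_function_mono:
  assumes Y: "young_function \<Phi>" and "0 \<le> x" "x \<le> y"
  shows "\<Phi> x \<le> \<Phi> y"
proof (cases "y = 0")
  case False
  have "\<Phi> (x / y * y) \<le> x / y * \<Phi> y"
    using assms False by (intro young_function_scale[OF Y]) auto
  also have "\<dots> \<le> 1 * \<Phi> y"
    using assms False by (intro mult_right_mono) (auto simp: young_function_def)
  finally show ?thesis using False by simp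
qed (use assms in auto)

lemma young_function_double:
  assumes Y: "young_function \<Phi>"
  shows "2 * \<Phi> x \<le> \<Phi> (2 * x)"
  using young_function_scale[OF Y, of "1/2" "2 * x"] by simp

lemma young_function_nonneg: "young_function \<Phi> \<Longrightarrow> 0 \<le> \<Phi> x"
  and young_function_zero: "young_function \<Phi> \<Longrightarrow> \<Phi> 0 = 0"
  by (auto simp: young_function_def)

lemma young_function_measurable:
  "young_function \<Phi> \<Longrightarrow> \<Phi> \<in> borel_measurable borel"
  by (auto simp: young_function_def intro: borel_measurable_continuous_onI)

text \<open>Dividing the argument by \<open>K\<close> divides the modular by at least \<open>K\<close>, by convexity. This turns
  every finite bound on the modular into the bound \<open>1\<close> that the norm asks for.\<close>

lemma modular_scale_le_1:
  assumes Y: "young_function \<Phi>" and [measurable]: "h \<in> borel_measurable \<mu>" and K: "1 \<le> K"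
    and le: "(\<integral>\<^sup>+x. ennreal (\<Phi> (h x)) \<partial>\<mu>) \<le> ennreal K"
  shows "(\<integral>\<^sup>+x. ennreal (\<Phi> (h x / K)) \<partial>\<mu>) \<le> 1"
proof -
  note [measurable] = young_function_measurable[OF Y]
  have "(\<integral>\<^sup>+x. ennreal (\<Phi> (h x / K)) \<partial>\<mu>) \<le> (\<integral>\<^sup>+x. ennreal (1/K) * ennreal (\<Phi> (h x)) \<partial>\<mu>)"
    using young_function_scale[OF Y, of "1/K"] K young_function_nonneg[OF Y]
    by (intro nn_integral_mono) (simp add: ennreal_leI flip: ennreal_mult)
  also have "\<dots> = ennreal (1/K) * (\<integral>\<^sup>+x. ennreal (\<Phi> (h x)) \<partial>\<mu>)"
    by (intro nn_integral_cmult) simp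
  also have "\<dots> \<le> ennreal (1/K) * ennreal K"
    using le by (intro mult_left_mono) auto
  also have "\<dots> = 1" using K by (simp flip: ennreal_mult)
  finally show ?thesis .
qed

lemma orlicz_spaceI:
  assumes "f \<in> borel_measurable \<mu>" "0 < k" "(\<integral>\<^sup>+x. ennreal (\<Phi> (cmod (f x) / k)) \<partial>\<mu>) \<le> 1"
  shows "f \<in> orlicz_space \<Phi> \<mu>"
proof -
  have "(\<integral>\<^sup>+x. ennreal (\<Phi> (1/k * cmod (f x))) \<partial>\<mu>) < \<infinity>"
    using assms(3) by (simp add: order_le_less_trans[OF _ ennreal_one_less_top])
  moreover have "0 < 1 / k" using assms(2) by simp
  ultimately show ?thesis using assms(1) unfolding orlicz_space_def by blast
qed

lemma orlicz_norm_le: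
  assumes "0 < k" "(\<integral>\<^sup>+x. ennreal (\<Phi> (cmod (f x) / k)) \<partial>\<mu>) \<le> 1"
  shows "orlicz_norm \<Phi> \<mu> f \<le> k"
  unfolding orlicz_norm_def using assms by (intro cInf_lower bdd_belowI[of _ 0]) auto

lemma orlicz_norm_set_nonempty:
  assumes Y: "young_function \<Phi>" and f: "f \<in> orlicz_space \<Phi> \<mu>"
  shows "\<exists>k>0. (\<integral>\<^sup>+x. ennreal (\<Phi> (cmod (f x) / k)) \<partial>\<mu>) \<le> 1"
proof -
  obtain k where [measurable]: "f \<in> borel_measurable \<mu>" and k: "0 < k"
    "(\<integral>\<^sup>+x. ennreal (\<Phi> (k * cmod (f x))) \<partial>\<mu>) < \<infinity>" using f by (auto simp: orlicz_space_def)
  define I where "I = enn2real (\<integral>\<^sup>+x. ennreal (\<Phi> (k * cmod (f x))) \<partial>\<mu>)"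
  have "(\<integral>\<^sup>+x. ennreal (\<Phi> (k * cmod (f x))) \<partial>\<mu>) = ennreal I" "0 \<le> I"
    using k(2) by (auto simp: I_def)
  then have "(\<integral>\<^sup>+x. ennreal (\<Phi> (k * cmod (f x) / (1 + I))) \<partial>\<mu>) \<le> 1"
    by (intro modular_scale_le_1[OF Y]) (auto intro!: ennreal_leI)
  moreover have "k * cmod (f x) / (1 + I) = cmod (f x) / ((1 + I) / k)" for x by simp
  ultimately show ?thesis using k \<open>0 \<le> I\<close> by (intro exI[of _ "(1 + I) / k"]) (auto simp: divide_simps)
qed

lemma orlicz_norm_nonneg:
  assumes "young_function \<Phi>" "f \<in> orlicz_space \<Phi> \<mu>"
  shows "0 \<le> orlicz_norm \<Phi> \<mu> f"
  unfolding orlicz_norm_def using orlicz_norm_set_nonempty[OF assms] by (intro cInf_greatest) auto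

text \<open>The converse of \<open>orlicz_norm_le\<close>, with a strict inequality so that it needs no argument about
  attaining the infimum in the norm.\<close>

lemma modular_le_1_if_orlicz_norm_less:
  assumes Y: "young_function \<Phi>" and f: "f \<in> orlicz_space \<Phi> \<mu>" and less: "orlicz_norm \<Phi> \<mu> f < k"
  shows "(\<integral>\<^sup>+x. ennreal (\<Phi> (cmod (f x) / k)) \<partial>\<mu>) \<le> 1"
proof -
  have "{k. 0 < k \<and> (\<integral>\<^sup>+x. ennreal (\<Phi> (cmod (f x) / k)) \<partial>\<mu>) \<le> 1} \<noteq> {}"
    using orlicz_norm_set_nonempty[OF Y f] by blast
  from cInf_lessD[OF this less[unfolded orlicz_norm_def]]
  obtain j where j: "0 < j" "j < k" "(\<integral>\<^sup>+x. ennreal (\<Phi> (cmod (f x) / j)) \<partial>\<mu>) \<le> 1" by blast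
  have "(\<integral>\<^sup>+x. ennreal (\<Phi> (cmod (f x) / k)) \<partial>\<mu>) \<le> (\<integral>\<^sup>+x. ennreal (\<Phi> (cmod (f x) / j)) \<partial>\<mu>)"
    using j by (intro nn_integral_mono ennreal_leI young_function_mono[OF Y] divide_left_mono) auto
  with j(3) show ?thesis by (rule order_trans[rotated])
qed

section \<open>Sufficiency of the pointwise condition\<close>

lemma pointwise_bound_imp_bounded:
  assumes Y1: "young_function \<Phi>\<^sub>1" and Y2: "young_function \<Phi>\<^sub>2"
    and u[measurable]: "u \<in> borel_measurable \<mu>"
    and M: "0 < M" and g: "g \<in> L1_nonneg \<mu>"
    and bound: "AE x in \<mu>. \<forall>v>0. \<Phi>\<^sub>2 (cmod (u x) * v) \<le> \<Phi>\<^sub>1 (M * v) + g x"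
  shows "bounded_orlicz_operator \<Phi>\<^sub>1 \<Phi>\<^sub>2 \<mu> (mult_op u)"
proof -
  note [measurable] = young_function_measurable[OF Y1] young_function_measurable[OF Y2]
  have gi: "integrable \<mu> g" and g0: "\<And>x. x \<in> space \<mu> \<Longrightarrow> 0 \<le> g x"
    using g by (auto simp: L1_nonneg_def)
  have [measurable]: "g \<in> borel_measurable \<mu>" using gi by auto
  define I where "I = integral\<^sup>L \<mu> g"
  have I: "0 \<le> I" unfolding I_def using g0 by (intro integral_nonneg_AE) auto
  have gI: "(\<integral>\<^sup>+x. ennreal (g x) \<partial>\<mu>) = ennreal I"
    unfolding I_def using gi g0 by (intro nn_integral_eq_integral) auto
  define C where "C = M * (1 + I)"
  have C: "0 < C" using M I by (simp add: C_def)
  have key: "(\<integral>\<^sup>+x. ennreal (\<Phi>\<^sub>2 (cmod (mult_op u f x) / (C * k))) \<partial>\<mu>) \<le> 1"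
    if f: "f \<in> orlicz_space \<Phi>\<^sub>1 \<mu>" and k: "orlicz_norm \<Phi>\<^sub>1 \<mu> f < k" "0 < k" for f k
  proof -
    have [measurable]: "f \<in> borel_measurable \<mu>" using f by (auto simp: orlicz_space_def)
    let ?h = "\<lambda>x. cmod (u x) * (cmod (f x) / (M * k))"
    have "(\<integral>\<^sup>+x. ennreal (\<Phi>\<^sub>2 (?h x)) \<partial>\<mu>)
        \<le> (\<integral>\<^sup>+x. ennreal (\<Phi>\<^sub>1 (cmod (f x) / k)) + ennreal (g x) \<partial>\<mu>)"
    proof (rule nn_integral_mono_AE)
      show "AE x in \<mu>. ennreal (\<Phi>\<^sub>2 (?h x)) \<le> ennreal (\<Phi>\<^sub>1 (cmod (f x) / k)) + ennreal (g x)"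
        using bound AE_space
      proof eventually_elim
        case (elim x)
        show ?case
        proof (cases "f x = 0")
          case True
          then show ?thesis by (simp add: young_function_zero[OF Y2])
        next
          case False
          then have "0 < cmod (f x) / (M * k)" using M k by simp
          with elim(1) have "\<Phi>\<^sub>2 (?h x) \<le> \<Phi>\<^sub>1 (M * (cmod (f x) / (M * k))) + g x" by blast
          also have "M * (cmod (f x) / (M * k)) = cmod (f x) / k" using M by simp
          finally show ?thesis
            using g0[OF elim(2)] young_function_nonneg[OF Y1]
            by (simp add: ennreal_leI flip: ennreal_plus)
        qed
      qed
    qed
    also have "\<dots> = (\<integral>\<^sup>+x. ennreal (\<Phi>\<^sub>1 (cmod (f x) / k)) \<partial>\<mu>) + (\<integral>\<^sup>+x. ennreal (g x) \<partial>\<mu>)"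
      by (intro nn_integral_add) auto
    also have "\<dots> \<le> 1 + ennreal I"
      unfolding gI using modular_le_1_if_orlicz_norm_less[OF Y1 f k(1)] by (intro add_right_mono)
    also have "\<dots> = ennreal (1 + I)" using I by simp
    finally have "(\<integral>\<^sup>+x. ennreal (\<Phi>\<^sub>2 (?h x / (1 + I))) \<partial>\<mu>) \<le> 1"
      using I by (intro modular_scale_le_1[OF Y2]) auto
    moreover have "?h x / (1 + I) = cmod (mult_op u f x) / (C * k)" for x
      by (simp add: C_def mult_op_def norm_mult field_simps)
    ultimately show ?thesis by simp
  qed
  have mem: "mult_op u f \<in> orlicz_space \<Phi>\<^sub>2 \<mu>" if f: "f \<in> orlicz_space \<Phi>\<^sub>1 \<mu>" for f
  proof -
    have [measurable]: "f \<in> borel_measurable \<mu>" using f by (auto simp: orlicz_space_def)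
    define k where "k = orlicz_norm \<Phi>\<^sub>1 \<mu> f + 1"
    have k: "orlicz_norm \<Phi>\<^sub>1 \<mu> f < k" "0 < k"
      using orlicz_norm_nonneg[OF Y1 f] by (auto simp: k_def)
    have "mult_op u f \<in> borel_measurable \<mu>" by (simp add: mult_op_def)
    then show ?thesis
      by (rule orlicz_spaceI[where k = "C * k"]) (use key[OF f k] C k in auto)
  qed
  have "orlicz_norm \<Phi>\<^sub>2 \<mu> (mult_op u f) \<le> C * orlicz_norm \<Phi>\<^sub>1 \<mu> f"
    if f: "f \<in> orlicz_space \<Phi>\<^sub>1 \<mu>" for f
  proof -
    have "orlicz_norm \<Phi>\<^sub>2 \<mu> (mult_op u f) / C \<le> orlicz_norm \<Phi>\<^sub>1 \<mu> f"
    proof (rule dense_ge)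
      fix k assume k: "orlicz_norm \<Phi>\<^sub>1 \<mu> f < k"
      then have "0 < k" using orlicz_norm_nonneg[OF Y1 f] by simp
      then show "orlicz_norm \<Phi>\<^sub>2 \<mu> (mult_op u f) / C \<le> k"
        using orlicz_norm_le[OF _ key[OF f k]] C by (simp add: field_simps)
    qed
    then show ?thesis using C by (simp add: field_simps)
  qed
  then show ?thesis unfolding bounded_orlicz_operator_def using mem C by blast
qed

section \<open>Necessity of the pointwise condition\<close>

text \<open>Any \<open>K\<close> larger than the operator norm serves: it lies strictly above the norm of the image of
  the unit ball, so the modular of the image at scale \<open>K\<close> is at most \<open>1\<close>.\<close>

lemma bounded_imp_modular_bound:
  assumes Y1: "young_function \<Phi>\<^sub>1" and Y2: "young_function \<Phi>\<^sub>2"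
    and "bounded_orlicz_operator \<Phi>\<^sub>1 \<Phi>\<^sub>2 \<mu> T"
  shows "\<exists>K>0. \<forall>f\<in>borel_measurable \<mu>. (\<integral>\<^sup>+x. ennreal (\<Phi>\<^sub>1 (cmod (f x))) \<partial>\<mu>) \<le> 1 \<longrightarrow>
           (\<integral>\<^sup>+x. ennreal (\<Phi>\<^sub>2 (cmod (T f x) / K)) \<partial>\<mu>) \<le> 1"
proof -
  obtain C where C: "0 < C"
    and mem: "\<And>f. f \<in> orlicz_space \<Phi>\<^sub>1 \<mu> \<Longrightarrow> T f \<in> orlicz_space \<Phi>\<^sub>2 \<mu>"
    and le: "\<And>f. f \<in> orlicz_space \<Phi>\<^sub>1 \<mu> \<Longrightarrow> orlicz_norm \<Phi>\<^sub>2 \<mu> (T f) \<le> C * orlicz_norm \<Phi>\<^sub>1 \<mu> f"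
    using assms(3) unfolding bounded_orlicz_operator_def by blast
  have "(\<integral>\<^sup>+x. ennreal (\<Phi>\<^sub>2 (cmod (T f x) / (2 * C))) \<partial>\<mu>) \<le> 1"
    if f: "f \<in> borel_measurable \<mu>" and f1: "(\<integral>\<^sup>+x. ennreal (\<Phi>\<^sub>1 (cmod (f x))) \<partial>\<mu>) \<le> 1" for f
  proof -
    have mem1: "f \<in> orlicz_space \<Phi>\<^sub>1 \<mu>" using f f1 by (intro orlicz_spaceI[where k = 1]) auto
    have "orlicz_norm \<Phi>\<^sub>1 \<mu> f \<le> 1" using f1 by (intro orlicz_norm_le) auto
    then have "C * orlicz_norm \<Phi>\<^sub>1 \<mu> f \<le> C * 1" using C by (intro mult_left_mono) auto
    then have "orlicz_norm \<Phi>\<^sub>2 \<mu> (T f) < 2 * C" using le[OF mem1] C by linarith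
    then show ?thesis by (rule modular_le_1_if_orlicz_norm_less[OF Y2 mem[OF mem1]])
  qed
  then show ?thesis using C by (intro exI[of _ "2 * C"]) auto
qed

text \<open>The core of the argument. In the application \<open>\<alpha>\<close> and \<open>\<beta>\<close> are \<open>\<Phi>\<^sub>1\<close> and \<open>\<Phi>\<^sub>2\<close> of a function and
  of its image, and \<open>loc\<close> is boundedness tested on the restrictions of this function. The factor \<open>2\<close>
  matches the factor by which \<open>\<integral>\<^sub>E \<alpha>\<close> may fall short of \<open>1\<close> on the set \<open>E\<close> that nonatomicity provides:
  \<open>\<integral>\<^sub>E \<alpha> > 1/2\<close> would force \<open>\<integral>\<^sub>E \<beta> > 1\<close>. Hence \<open>\<alpha>\<close> is small on the whole space, where \<open>loc\<close> then
  bounds \<open>\<beta>\<close> itself.\<close>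

lemma excess_integral_le_1:
  assumes sf: "sigma_finite_measure \<mu>" and na: "nonatomic \<mu>"
    and [measurable]: "\<alpha> \<in> borel_measurable \<mu>" "\<beta> \<in> borel_measurable \<mu>"
    and nonneg: "\<And>x. 0 \<le> \<alpha> x" and dom: "\<And>x. 2 * \<alpha> x \<le> \<beta> x"
    and loc: "\<And>E. E \<in> sets \<mu> \<Longrightarrow> (\<integral>\<^sup>+x\<in>E. ennreal (\<alpha> x) \<partial>\<mu>) \<le> 1 \<Longrightarrow> (\<integral>\<^sup>+x\<in>E. ennreal (\<beta> x) \<partial>\<mu>) \<le> 1"
  shows "(\<integral>\<^sup>+x. ennreal (\<beta> x - 2 * \<alpha> x) \<partial>\<mu>) \<le> 1"
proof -
  let ?N = "density \<mu> (\<lambda>x. ennreal (\<alpha> x))"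
  have sfN: "sigma_finite_measure ?N"
    by (subst sigma_finite_measure.sigma_finite_iff_density_finite[OF sf]) auto
  then interpret N: sigma_finite_measure ?N .
  have N: "emeasure ?N E = (\<integral>\<^sup>+x\<in>E. ennreal (\<alpha> x) \<partial>\<mu>)" if "E \<in> sets \<mu>" for E
    using that by (intro emeasure_density) auto
  have whole: "(\<integral>\<^sup>+x\<in>space \<mu>. h x \<partial>\<mu>) = (\<integral>\<^sup>+x. h x \<partial>\<mu>)" for h :: "'a \<Rightarrow> ennreal"
    by (intro nn_integral_cong) (auto simp: indicator_def)
  have "emeasure ?N (space \<mu>) \<le> 1"
  proof (rule ccontr)
    assume "\<not> ?thesis"
    then have "ennreal 1 < emeasure ?N (space \<mu>)" by (simp add: not_le)
    with N.nonatomic_subset_of_comparable_measure[OF nonatomic_density[OF na _ sfN], of "space \<mu>" 1]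
    obtain E where E[measurable]: "E \<in> sets \<mu>"
      and E1: "ennreal (1/2) < emeasure ?N E" "emeasure ?N E \<le> 1"
      by auto
    have "1 = ennreal 2 * ennreal (1/2)" by (subst ennreal_mult[symmetric]) auto
    also have "\<dots> < ennreal 2 * emeasure ?N E"
      using E1(1) by (intro ennreal_mult_strict_left_mono) auto
    also have "\<dots> = (\<integral>\<^sup>+x\<in>E. ennreal (2 * \<alpha> x) \<partial>\<mu>)"
      using nonneg unfolding N[OF E]
      by (subst nn_integral_cmult[symmetric]) (auto simp: ennreal_mult mult.assoc)
    also have "\<dots> \<le> (\<integral>\<^sup>+x\<in>E. ennreal (\<beta> x) \<partial>\<mu>)"
      using dom by (intro nn_integral_mono mult_right_mono ennreal_leI) auto
    also have "\<dots> \<le> 1" using loc[OF E] E1(2) N[OF E] by simp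
    finally show False by simp
  qed
  then have "(\<integral>\<^sup>+x\<in>space \<mu>. ennreal (\<beta> x) \<partial>\<mu>) \<le> 1"
    by (intro loc) (auto simp: N)
  moreover have "(\<integral>\<^sup>+x. ennreal (\<beta> x - 2 * \<alpha> x) \<partial>\<mu>) \<le> (\<integral>\<^sup>+x. ennreal (\<beta> x) \<partial>\<mu>)"
    using nonneg by (intro nn_integral_mono ennreal_leI) auto
  ultimately show ?thesis unfolding whole by (rule order_trans[rotated])
qed

text \<open>A point among \<open>0, r 0, \<dots>, r (n - 1)\<close> at which \<open>G x\<close> is largest. Considering the candidates one
  at a time reduces measurability in \<open>x\<close> to an induction on \<open>n\<close>; starting at \<open>0\<close> keeps the maximum at
  least \<open>G x 0\<close>, which is \<open>0\<close> in the application.\<close>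

primrec running_argmax :: "('a \<Rightarrow> real \<Rightarrow> real) \<Rightarrow> (nat \<Rightarrow> real) \<Rightarrow> nat \<Rightarrow> 'a \<Rightarrow> real" where
  "running_argmax G r 0 x = 0"
| "running_argmax G r (Suc n) x =
     (if G x (running_argmax G r n x) < G x (r n) then r n else running_argmax G r n x)"

lemma incseq_running_argmax: "incseq (\<lambda>n. G x (running_argmax G r n x))"
  by (intro incseq_SucI) auto

lemma running_argmax_nonneg: "(\<And>n. 0 \<le> r n) \<Longrightarrow> 0 \<le> running_argmax G r n x"
  by (induction n) auto

lemma running_argmax_measurable:
  assumes [measurable]: "(\<lambda>(x, w). G x w) \<in> borel_measurable (\<mu> \<Otimes>\<^sub>M borel)"
  shows "running_argmax G r n \<in> borel_measurable \<mu>"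
proof (induction n)
  case (Suc n)
  note [measurable] = Suc
  show ?case by simp
next
  case 0
  have "running_argmax G r 0 = (\<lambda>_. 0)" by auto
  then show ?case by simp
qed

lemma nonatomic_bounded_imp_pointwise_bound:
  assumes sf: "sigma_finite_measure \<mu>" and na: "nonatomic \<mu>"
    and Y1: "young_function \<Phi>\<^sub>1" and Y2: "young_function \<Phi>\<^sub>2"
    and u[measurable]: "u \<in> borel_measurable \<mu>"
    and bdd: "bounded_orlicz_operator \<Phi>\<^sub>1 \<Phi>\<^sub>2 \<mu> (mult_op u)"
  shows "\<exists>M>0. \<exists>g \<in> L1_nonneg \<mu>. \<exists>A \<in> sets \<mu>. emeasure \<mu> A = 0 \<and>
             (\<forall>v>0. \<forall>x \<in> space \<mu> - A. \<Phi>\<^sub>2 (cmod (u x) * v) \<le> \<Phi>\<^sub>1 (M * v) + g x)"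
proof -
  note [measurable] = young_function_measurable[OF Y1] young_function_measurable[OF Y2]
  obtain K where K: "0 < K" and modular:
    "\<And>f. f \<in> borel_measurable \<mu> \<Longrightarrow> (\<integral>\<^sup>+x. ennreal (\<Phi>\<^sub>1 (cmod (f x))) \<partial>\<mu>) \<le> 1 \<Longrightarrow>
           (\<integral>\<^sup>+x. ennreal (\<Phi>\<^sub>2 (cmod (u x * f x) / K)) \<partial>\<mu>) \<le> 1"
    using bounded_imp_modular_bound[OF Y1 Y2 bdd] unfolding mult_op_def by blast
  define G where "G x w = \<Phi>\<^sub>2 (cmod (u x) * w / K) - 2 * \<Phi>\<^sub>1 w" for x w
  define r where "r n = \<bar>real_of_rat (nat_to_rat_surj n)\<bar>" for n
  define s where "s = running_argmax G r"
  have [measurable]: "(\<lambda>(x, w). G x w) \<in> borel_measurable (\<mu> \<Otimes>\<^sub>M borel)"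
    unfolding G_def by measurable
  have s_meas[measurable]: "s n \<in> borel_measurable \<mu>" for n
    unfolding s_def by (rule running_argmax_measurable) simp
  have s0: "0 \<le> s n x" for n x
    unfolding s_def by (rule running_argmax_nonneg) (simp add: r_def)
  have inc: "incseq (\<lambda>n. G x (s n x))" for x
    unfolding s_def by (rule incseq_running_argmax)
  have G0: "0 \<le> G x (s n x)" for n x
    using incseqD[OF inc, of 0 n x]
    by (simp add: s_def G_def young_function_zero[OF Y1] young_function_zero[OF Y2])
  have Gr: "G x (r n) \<le> G x (s (Suc n) x)" for n x
    by (simp add: s_def)

  \<comment> \<open>The restrictions of \<open>s n\<close> to measurable sets are the test functions for boundedness.\<close>
  have int_le: "(\<integral>\<^sup>+x. ennreal (G x (s n x)) \<partial>\<mu>) \<le> 1" for n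
    unfolding G_def
  proof (rule excess_integral_le_1[OF sf na])
    show "2 * \<Phi>\<^sub>1 (s n x) \<le> \<Phi>\<^sub>2 (cmod (u x) * s n x / K)" for x
      using G0[of x n] by (simp add: G_def)
    fix E assume E[measurable]: "E \<in> sets \<mu>" and le: "(\<integral>\<^sup>+x\<in>E. ennreal (\<Phi>\<^sub>1 (s n x)) \<partial>\<mu>) \<le> 1"
    define f where "f x = complex_of_real (s n x * indicator E x)" for x
    have "(\<integral>\<^sup>+x. ennreal (\<Phi>\<^sub>1 (cmod (f x))) \<partial>\<mu>) = (\<integral>\<^sup>+x\<in>E. ennreal (\<Phi>\<^sub>1 (s n x)) \<partial>\<mu>)"
      using s0 by (intro nn_integral_cong)
        (auto simp: f_def indicator_def young_function_zero[OF Y1])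
    moreover have "f \<in> borel_measurable \<mu>" unfolding f_def by measurable
    ultimately have "(\<integral>\<^sup>+x. ennreal (\<Phi>\<^sub>2 (cmod (u x * f x) / K)) \<partial>\<mu>) \<le> 1"
      using le by (intro modular) auto
    also have "(\<integral>\<^sup>+x. ennreal (\<Phi>\<^sub>2 (cmod (u x * f x) / K)) \<partial>\<mu>)
        = (\<integral>\<^sup>+x\<in>E. ennreal (\<Phi>\<^sub>2 (cmod (u x) * s n x / K)) \<partial>\<mu>)"
      using s0 by (intro nn_integral_cong)
        (auto simp: f_def indicator_def norm_mult young_function_zero[OF Y2])
    finally show "(\<integral>\<^sup>+x\<in>E. ennreal (\<Phi>\<^sub>2 (cmod (u x) * s n x / K)) \<partial>\<mu>) \<le> 1" .
  qed (auto simp: young_function_nonneg[OF Y1])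

  define H where "H x = (SUP n. ennreal (G x (s n x)))" for x
  have G_meas[measurable]: "(\<lambda>x. G x (s n x)) \<in> borel_measurable \<mu>" for n by measurable
  have H_meas[measurable]: "H \<in> borel_measurable \<mu>"
    unfolding H_def by measurable
  have "(\<integral>\<^sup>+x. H x \<partial>\<mu>) = (SUP n. \<integral>\<^sup>+x. ennreal (G x (s n x)) \<partial>\<mu>)"
    unfolding H_def using inc
    by (intro nn_integral_monotone_convergence_SUP)
       (auto simp: incseq_def le_fun_def intro!: ennreal_leI)
  also have "\<dots> \<le> 1" using int_le by (intro SUP_least)
  finally have H1: "(\<integral>\<^sup>+x. H x \<partial>\<mu>) \<le> 1" .
  then have Hfin: "AE x in \<mu>. H x \<noteq> \<infinity>"
    by (intro nn_integral_PInf_AE) (auto simp: top_unique)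
  define A where "A = {x \<in> space \<mu>. H x = \<infinity>}"
  have A[measurable]: "A \<in> sets \<mu>" unfolding A_def by measurable
  have A0: "emeasure \<mu> A = 0"
    using Hfin by (subst (asm) AE_iff_measurable[of A]) (auto simp: A_def)
  define g where "g x = enn2real (H x)" for x
  have [measurable]: "g \<in> borel_measurable \<mu>" unfolding g_def by measurable
  have "(\<integral>\<^sup>+x. ennreal (norm (g x)) \<partial>\<mu>) \<le> (\<integral>\<^sup>+x. H x \<partial>\<mu>)"
    by (intro nn_integral_mono) (auto simp: g_def ennreal_enn2real_if)
  also have "\<dots> < \<infinity>" using H1 by (rule order_le_less_trans) simp
  finally have "integrable \<mu> g" by (intro integrableI_bounded) auto
  then have g: "g \<in> L1_nonneg \<mu>" by (auto simp: L1_nonneg_def g_def)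

  \<comment> \<open>The \<open>r n\<close> are dense in the nonnegative reals only; composing with the absolute value lets the
    density of the rationals in the whole line be used.\<close>
  have G_le: "G x w \<le> g x" if x: "x \<in> space \<mu> - A" and w: "0 \<le> w" for x w
  proof -
    have cont: "continuous_on UNIV (\<lambda>w. G x \<bar>w\<bar>)"
    proof -
      have c1: "continuous_on UNIV \<Phi>\<^sub>1" and c2: "continuous_on UNIV \<Phi>\<^sub>2"
        using Y1 Y2 by (auto simp: young_function_def)
      have "continuous_on UNIV (\<lambda>w. \<Phi>\<^sub>1 \<bar>w\<bar>)"
        by (rule continuous_on_compose2[OF c1]) (auto intro!: continuous_intros)
      moreover have "continuous_on UNIV (\<lambda>w. \<Phi>\<^sub>2 (cmod (u x) * \<bar>w\<bar> / K))"
        using K by (intro continuous_on_compose2[OF c2]) (auto intro!: continuous_intros)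
      ultimately show ?thesis unfolding G_def
        by (intro continuous_on_diff continuous_on_mult_left)
    qed
    have "G x (r n) \<le> g x" for n
    proof -
      have "ennreal (G x (r n)) \<le> ennreal (G x (s (Suc n) x))" by (intro ennreal_leI Gr)
      also have "\<dots> \<le> H x" unfolding H_def by (intro SUP_upper) auto
      also have "\<dots> = ennreal (g x)" using x by (auto simp: A_def g_def less_top)
      finally show ?thesis by (simp add: g_def ennreal_le_iff)
    qed
    then have "\<rat> \<subseteq> {w. G x \<bar>w\<bar> \<le> g x}"
      by (auto elim!: Rats_cases simp: r_def) (metis surj_nat_to_rat_surj surjD)
    moreover have "closed {w. G x \<bar>w\<bar> \<le> g x}"
      using cont by (intro closed_Collect_le continuous_intros)
    ultimately have "closure \<rat> \<subseteq> {w. G x \<bar>w\<bar> \<le> g x}" by (rule closure_minimal)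
    then have "G x \<bar>w\<bar> \<le> g x" using Rats_closure_real by blast
    then show ?thesis using w by simp
  qed
  have "\<Phi>\<^sub>2 (cmod (u x) * v) \<le> \<Phi>\<^sub>1 (2 * K * v) + g x" if v: "0 < v" and x: "x \<in> space \<mu> - A" for v x
  proof -
    have "\<Phi>\<^sub>2 (cmod (u x) * v) \<le> 2 * \<Phi>\<^sub>1 (K * v) + g x"
      using G_le[OF x, of "K * v"] v K by (simp add: G_def)
    also have "2 * \<Phi>\<^sub>1 (K * v) \<le> \<Phi>\<^sub>1 (2 * K * v)"
      using young_function_double[OF Y1, of "K * v"] by (simp add: mult.assoc)
    finally show ?thesis by simp
  qed
  then show ?thesis using K g A A0 by (intro exI[of _ "2 * K"] conjI bexI[of _ g] bexI[of _ A]) auto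
qed

theorem theorem2p4:
  fixes \<mu> :: "'a measure" and \<Phi>\<^sub>1 \<Phi>\<^sub>2 :: "real \<Rightarrow> real" and u :: "'a \<Rightarrow> complex"
  assumes "sigma_finite_measure \<mu>" and "complete_measure \<mu>"
    and "young_function \<Phi>\<^sub>1" and "young_function \<Phi>\<^sub>2"
    and "u \<in> borel_measurable \<mu>"
  shows "((\<exists>M>0. \<exists>g \<in> L1_nonneg \<mu>. \<exists>A \<in> sets \<mu>. emeasure \<mu> A = 0 \<and>
             (\<forall>v>0. \<forall>x \<in> space \<mu> - A. \<Phi>\<^sub>2 (cmod (u x) * v) \<le> \<Phi>\<^sub>1 (M * v) + g x))
           \<longrightarrow> bounded_orlicz_operator \<Phi>\<^sub>1 \<Phi>\<^sub>2 \<mu> (mult_op u))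
       \<and> (nonatomic \<mu> \<and> bounded_orlicz_operator \<Phi>\<^sub>1 \<Phi>\<^sub>2 \<mu> (mult_op u)
           \<longrightarrow> (\<exists>M>0. \<exists>g \<in> L1_nonneg \<mu>. \<exists>A \<in> sets \<mu>. emeasure \<mu> A = 0 \<and>
             (\<forall>v>0. \<forall>x \<in> space \<mu> - A. \<Phi>\<^sub>2 (cmod (u x) * v) \<le> \<Phi>\<^sub>1 (M * v) + g x)))"
proof (intro conjI impI)
  assume "\<exists>M>0. \<exists>g \<in> L1_nonneg \<mu>. \<exists>A \<in> sets \<mu>. emeasure \<mu> A = 0 \<and>
             (\<forall>v>0. \<forall>x \<in> space \<mu> - A. \<Phi>\<^sub>2 (cmod (u x) * v) \<le> \<Phi>\<^sub>1 (M * v) + g x)"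
  then obtain M g A where M: "0 < M" and g: "g \<in> L1_nonneg \<mu>"
    and A: "A \<in> sets \<mu>" "emeasure \<mu> A = 0"
    and bound: "\<And>v x. 0 < v \<Longrightarrow> x \<in> space \<mu> - A \<Longrightarrow> \<Phi>\<^sub>2 (cmod (u x) * v) \<le> \<Phi>\<^sub>1 (M * v) + g x"
    by blast
  have "AE x in \<mu>. \<forall>v>0. \<Phi>\<^sub>2 (cmod (u x) * v) \<le> \<Phi>\<^sub>1 (M * v) + g x"
    using A bound by (intro AE_I'[of A]) (auto simp: null_sets_def)
  then show "bounded_orlicz_operator \<Phi>\<^sub>1 \<Phi>\<^sub>2 \<mu> (mult_op u)"
    by (rule pointwise_bound_imp_bounded[OF assms(3-5) M g])
qed (use nonatomic_bounded_imp_pointwise_bound[OF assms(1) _ assms(3-5)] in blast)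

end
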